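(* Let $\mathcal{H}$ and $\mathcal{K}$ be finite dimensional Hilbert spaces and let $A\in\mathcal{L}(\mathcal{K})$ and $B\in\mathcal{L}(\mathcal{H})$ with $\sigma(A)\cap\sigma(B)=\emptyset$. Then for every $Y\in\mathcal{L}(\mathcal{H},\mathcal{K})$ there exists a unique $X\in\mathcal{L}(\mathcal{H},\mathcal{K})$ such that $AX-XB=Y$.
   Context: $\mathcal{L}(\mathcal{H},\mathcal{K})$ denotes the space of linear operators from $\mathcal{H}$ to $\mathcal{K}$, and $\mathcal{L}(\mathcal{H})=\mathcal{L}(\mathcal{H},\mathcal{H})$, $\mathcal{L}(\mathcal{K})=\mathcal{L}(\mathcal{K},\mathcal{K})$. For an operator $T$, $\sigma(T)$ denotes the spectrum of $T$. *)

theory Defs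
  imports "HOL-Analysis.Analysis"
begin

text \<open>
  Hilbert spaces are complex. The underlying vector space is a whole type with its additive group
  structure, and scalar multiplication and inner product are parameters, so that the trivial space
  is included. The inner product is linear in its first argument.
\<close>

locale complex_inner_product_space = vector_space scale
  for scale :: "complex \<Rightarrow> 'a::ab_group_add \<Rightarrow> 'a" +
  fixes ip :: "'a \<Rightarrow> 'a \<Rightarrow> complex"
  assumes ip_add_left: "ip (x + y) z = ip x z + ip y z"
    and ip_scale_left: "ip (scale c x) y = c * ip x y"
    and ip_commute: "ip y x = cnj (ip x y)"
    and ip_self_nonneg: "0 \<le> Re (ip x x)"
    and ip_self_eq_0: "ip x x = 0 \<Longrightarrow> x = 0"

definition ip_dist :: "('a::ab_group_add \<Rightarrow> 'a \<Rightarrow> complex) \<Rightarrow> 'a \<Rightarrow> 'a \<Rightarrow> real" where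
  "ip_dist ip x y = sqrt (Re (ip (x - y) (x - y)))"

locale complex_hilbert_space = complex_inner_product_space scale ip
  for scale :: "complex \<Rightarrow> 'a::ab_group_add \<Rightarrow> 'a" and ip +
  assumes complete: "Metric_space.mcomplete UNIV (ip_dist ip)"

locale finite_dim_complex_hilbert_space = complex_hilbert_space scale ip
  for scale :: "complex \<Rightarrow> 'a::ab_group_add \<Rightarrow> 'a" and ip +
  assumes finite_dim: "\<exists>S. finite S \<and> span S = UNIV"

text \<open>
  The inverse is only required to be linear: on a finite-dimensional space every linear operator
  is bounded, so this is the usual spectrum there.
\<close>

definition operator_spectrum ::
    "(complex \<Rightarrow> 'a::ab_group_add \<Rightarrow> 'a) \<Rightarrow> ('a \<Rightarrow> 'a) \<Rightarrow> complex set" where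
  "operator_spectrum sc T =
     {c. \<not> (\<exists>R. Vector_Spaces.linear sc sc R \<and>
               (\<forall>x. R (T x - sc c x) = x) \<and>
               (\<forall>x. T (R x) - sc c (R x) = x))}"

end

theory Submission
  imports Defs "HOL-Computational_Algebra.Fundamental_Theorem_Algebra"
begin

text \<open>
  Let \<open>p\<close> be a product of linear factors \<open>z - c\<close> with \<open>c \<in> \<sigma>(B)\<close> that annihilates \<open>B\<close>; it exists
  because \<open>\<complex>\<close> is algebraically closed. By disjointness of the spectra \<open>p(A)\<close> is invertible.
  If \<open>A Z = Z B\<close>, then \<open>p(A) Z = Z p(B) = 0\<close>, so \<open>Z = 0\<close>. For existence, left multiplication by
  \<open>A\<close> and right multiplication by \<open>B\<close> commute, so \<open>p(A) Y - Y p(B)\<close> is a multiple of their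
  difference: it equals \<open>A W - W B\<close> for some \<open>W\<close>. Then \<open>X = p(A)\<^sup>-\<^sup>1 W\<close> solves the equation.
\<close>

section \<open>Products of shifts of one operator\<close>

text \<open>The operator \<open>p(T)\<close> for the polynomial \<open>p\<close> with root list
  \<open>cs\<close>. Keeping the roots as a list lets invertibility and membership in a spectrum be
  treated factor by factor.\<close>

primrec shift_prod :: "('f \<Rightarrow> 'a::ab_group_add \<Rightarrow> 'a) \<Rightarrow> ('a \<Rightarrow> 'a) \<Rightarrow> 'f list \<Rightarrow> 'a \<Rightarrow> 'a" where
  "shift_prod sc T [] x = x"
| "shift_prod sc T (c # cs) x = T (shift_prod sc T cs x) - sc c (shift_prod sc T cs x)"

lemma linearI:
  assumes "vector_space s" "vector_space t" "\<And>x y. f (x + y) = f x + f y" "\<And>c x. f (s c x) = t c (f x)"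
  shows "Vector_Spaces.linear s t f"
  using assms by (simp add: Vector_Spaces.linear_iff)

lemma linearD:
  assumes "Vector_Spaces.linear s t f"
  shows "vector_space s" "vector_space t" "f (x + y) = f x + f y" "f (s c x) = t c (f x)"
    "f (x - y) = f x - f y" "f 0 = 0"
proof -
  interpret Vector_Spaces.linear s t f by fact
  show "vector_space s" "vector_space t" "f (x + y) = f x + f y" "f (s c x) = t c (f x)"
    "f (x - y) = f x - f y" "f 0 = 0"
    by (rule vs1.vector_space_axioms vs2.vector_space_axioms add scale diff zero)+
qed

context vector_space
begin

lemma linear_shift:
  assumes "Vector_Spaces.linear s scale f"
  shows "Vector_Spaces.linear scale scale T \<Longrightarrow>
    Vector_Spaces.linear s scale (\<lambda>x. T (f x) - scale c (f x))"
  by (rule linearI)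
    (use linearD[OF assms] linearD[of scale scale T] vector_space_axioms in
      \<open>auto simp: algebra_simps mult.commute\<close>)

context
  fixes T :: "'b \<Rightarrow> 'b"
  assumes lin: "Vector_Spaces.linear scale scale T"
begin

lemma linear_shift_prod: "Vector_Spaces.linear scale scale (shift_prod scale T cs)"
proof (induction cs)
  case Nil
  show ?case by (rule linearI) (use vector_space_axioms in auto)
next
  case (Cons c cs)
  then show ?case using linear_shift[OF Cons lin, of c] by (simp add: fun_eq_iff)
qed

lemma shift_prod_commute: "shift_prod scale T cs (T x) = T (shift_prod scale T cs x)"
  by (induction cs) (simp_all add: linearD[OF lin])

lemma shift_prod_append:
  "shift_prod scale T (cs @ ds) x = shift_prod scale T cs (shift_prod scale T ds x)"
  by (induction cs) simp_all

lemma shift_prod_swap: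
  "shift_prod scale T cs (shift_prod scale T ds x) = shift_prod scale T ds (shift_prod scale T cs x)"
proof (induction ds)
  case (Cons d ds)
  then show ?case
    by (simp add: linearD[OF linear_shift_prod] shift_prod_commute)
qed simp

text \<open>Composing the inverses of the factors in reverse order inverts the product. This inverse
  commutes with \<open>T\<close> because the product does.\<close>

lemma shift_prod_inverse:
  assumes "\<And>c. c \<in> set cs \<Longrightarrow> \<exists>R. Vector_Spaces.linear scale scale R \<and>
    (\<forall>x. R (T x - scale c x) = x) \<and> (\<forall>x. T (R x) - scale c (R x) = x)"
  obtains Q where "Vector_Spaces.linear scale scale Q"
    "\<And>x. Q (shift_prod scale T cs x) = x" "\<And>x. shift_prod scale T cs (Q x) = x"
    "\<And>x. Q (T x) = T (Q x)"
proof -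
  have "\<exists>Q. Vector_Spaces.linear scale scale Q \<and>
    (\<forall>x. Q (shift_prod scale T cs x) = x) \<and> (\<forall>x. shift_prod scale T cs (Q x) = x)"
    using assms
  proof (induction cs)
    case Nil
    have "Vector_Spaces.linear scale scale (\<lambda>x. x)"
      by (rule linearI) (use vector_space_axioms in auto)
    then show ?case by auto
  next
    case (Cons c cs)
    then obtain Q where Q: "Vector_Spaces.linear scale scale Q"
      "\<And>x. Q (shift_prod scale T cs x) = x" "\<And>x. shift_prod scale T cs (Q x) = x"
      by auto
    obtain R where R: "Vector_Spaces.linear scale scale R"
      "\<And>x. R (T x - scale c x) = x" "\<And>x. T (R x) - scale c (R x) = x"
      using Cons.prems[of c] by auto
    have "Vector_Spaces.linear scale scale (\<lambda>x. Q (R x))"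
      by (rule linearI) (simp_all add: linearD[OF Q(1)] linearD[OF R(1)] vector_space_axioms)
    then show ?case using Q R by (intro exI[of _ "\<lambda>x. Q (R x)"]) auto
  qed
  then obtain Q where Q: "Vector_Spaces.linear scale scale Q"
      "\<And>x. Q (shift_prod scale T cs x) = x" "\<And>x. shift_prod scale T cs (Q x) = x"
    by auto
  have "Q (T x) = T (Q x)" for x
    by (metis Q(2,3) shift_prod_commute)
  with Q that show ?thesis by blast
qed

section \<open>Polynomials in one operator\<close>

definition peval :: "'a poly \<Rightarrow> 'b \<Rightarrow> 'b" where
  "peval p x = (\<Sum>i\<le>degree p. scale (coeff p i) ((T ^^ i) x))"

lemma peval_eq_sum:
  assumes "degree p \<le> n"
  shows "peval p x = (\<Sum>i\<le>n. scale (coeff p i) ((T ^^ i) x))"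
  unfolding peval_def
  by (rule sum.mono_neutral_left) (use assms coeff_eq_0 in \<open>auto simp: not_le\<close>)

lemma peval_linear_factor: "peval ([:- c, 1:] * p) x = T (peval p x) - scale c (peval p x)"
proof -
  interpret L: Vector_Spaces.linear scale scale T by (rule lin)
  let ?n = "degree p" and ?v = "\<lambda>i. (T ^^ i) x"
  have eq: "[:- c, 1:] * p = pCons 0 p - smult c p"
    by simp
  have le: "degree (pCons 0 p - smult c p) \<le> Suc ?n"
    by (intro degree_diff_le degree_pCons_le) (simp add: le_SucI)
  have "peval ([:- c, 1:] * p) x = (\<Sum>i\<le>Suc ?n. scale (coeff (pCons 0 p) i) (?v i))
      - scale c (\<Sum>i\<le>Suc ?n. scale (coeff p i) (?v i))"
    unfolding eq peval_eq_sum[OF le]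
    by (simp only: coeff_diff coeff_smult scale_left_diff_distrib sum_subtractf
      scale_sum_right scale_scale)
  \<comment> \<open>The summand at index 0 vanishes; shifting the remaining indices by one leaves
    one extra \<open>T\<close> in each summand.\<close>
  also have "(\<Sum>i\<le>Suc ?n. scale (coeff (pCons 0 p) i) (?v i)) = T (peval p x)"
    unfolding sum.atMost_Suc_shift by (simp add: peval_def L.sum L.scale)
  also have "(\<Sum>i\<le>Suc ?n. scale (coeff p i) (?v i)) = peval p x"
    by (rule peval_eq_sum[symmetric]) simp
  finally show ?thesis .
qed

text \<open>The \<open>card S + 1\<close> iterates from \<open>x\<close> to
  \<open>T^(card S) x\<close> cannot be independent, and the coefficients of a linear relation among
  them form \<open>p\<close>. Dependence is a property of a set of vectors, so coinciding iterates
  are a separate case.\<close>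

lemma annihilating_poly:
  assumes "finite S" "span S = UNIV"
  obtains p where "p \<noteq> 0" "peval p x = 0"
proof (cases "inj_on (\<lambda>i. (T ^^ i) x) {..card S}")
  case False
  then obtain i j where ij: "i < j" "(T ^^ i) x = (T ^^ j) x"
    by (auto simp: inj_on_def) (metis linorder_neqE_nat)
  \<comment> \<open>Two equal iterates already give a relation, namely
    \<open>T^j x - T^i x = 0\<close>.\<close>
  let ?p = "monom 1 j - monom 1 i :: 'a poly"
  have "coeff ?p j = 1" using ij by simp
  then have "?p \<noteq> 0" by force
  moreover have "peval ?p x = 0"
  proof -
    have "degree ?p \<le> j"
      using ij by (intro degree_diff_le) (auto simp: degree_monom_eq)
    then have "peval ?p x = (\<Sum>k\<le>j. if k = j then (T ^^ j) x else 0)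
        - (\<Sum>k\<le>j. if k = i then (T ^^ i) x else 0)"
      unfolding peval_eq_sum[OF \<open>degree ?p \<le> j\<close>] sum_subtractf[symmetric]
      by (intro sum.cong) (auto simp: scale_left_diff_distrib)
    then show ?thesis using ij by simp
  qed
  ultimately show ?thesis using that by blast
next
  case True
  let ?n = "card S" and ?v = "\<lambda>i. (T ^^ i) x"
  have "card (?v ` {..?n}) = Suc ?n"
    using True by (simp add: card_image)
  then have "dependent (?v ` {..?n})"
    using independent_span_bound[OF assms(1), of "?v ` {..?n}"] assms(2) by auto
  then obtain u where u: "\<exists>v\<in>?v ` {..?n}. u v \<noteq> 0" "(\<Sum>v\<in>?v ` {..?n}. scale (u v) v) = 0"
    using dependent_finite[of "?v ` {..?n}"] by auto
  \<comment> \<open>The relation \<open>u\<close> is indexed by vectors; injectivity of the iterates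
    turns it into coefficients indexed by exponents.\<close>
  define p where "p = (\<Sum>i\<le>?n. monom (u (?v i)) i)"
  have coeff: "coeff p k = (if k \<le> ?n then u (?v k) else 0)" for k
    by (simp add: p_def coeff_sum)
  have "p \<noteq> 0" using u(1) coeff by (metis (no_types, lifting) atMost_iff coeff_0 imageE)
  moreover have "degree p \<le> ?n" by (rule degree_le) (simp add: coeff)
  then have "peval p x = 0"
    using u(2) by (simp add: peval_eq_sum coeff sum.reindex[OF True])
  ultimately show ?thesis using that by blast
qed

end

end

section \<open>Annihilation by factors from the spectrum\<close>

text \<open>Concatenating the lists of the generators works: products of shifts commute, so the
  block that kills a given generator may act first. The kernel of the result is a subspace and so
  contains the span.\<close>

lemma (in vector_space) shift_prod_annihilates_span:
  assumes "Vector_Spaces.linear scale scale T" "finite S"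
    "\<And>x. x \<in> S \<Longrightarrow> \<exists>cs. set cs \<subseteq> C \<and> shift_prod scale T cs x = 0"
  obtains cs where "set cs \<subseteq> C" "\<And>x. x \<in> span S \<Longrightarrow> shift_prod scale T cs x = 0"
proof -
  note lin = linearD[OF linear_shift_prod[OF assms(1)]]
  have "\<exists>cs. set cs \<subseteq> C \<and> (\<forall>x\<in>S. shift_prod scale T cs x = 0)"
    using assms(2,3)
  proof (induction S)
    case empty
    show ?case by (intro exI[of _ "[]"]) simp
  next
    case (insert y S)
    then obtain cs ds where *: "set cs \<subseteq> C" "\<forall>x\<in>S. shift_prod scale T cs x = 0"
      "set ds \<subseteq> C" "shift_prod scale T ds y = 0"
      by (metis insert_iff)
    have "shift_prod scale T (cs @ ds) x = 0" if "x \<in> insert y S" for x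
      using that * unfolding shift_prod_append[OF assms(1)]
      by (metis insert_iff lin(6) shift_prod_swap[OF assms(1)])
    with * show ?case by (intro exI[of _ "cs @ ds"]) auto
  qed
  then obtain cs where cs: "set cs \<subseteq> C" "\<forall>x\<in>S. shift_prod scale T cs x = 0" by blast
  have "shift_prod scale T cs x = 0" if "x \<in> span S" for x
    using that by (induction rule: span_induct_alt) (simp_all add: lin cs)
  with cs that show ?thesis by blast
qed

text \<open>Roots of \<open>p\<close> are split off one at a time. A root in the spectrum is kept in
  the list; for any other root the factor is invertible and can be cancelled.\<close>

lemma shift_prod_spectrum_annihilates_vector:
  fixes sc :: "complex \<Rightarrow> 'a::ab_group_add \<Rightarrow> 'a"
  assumes "Vector_Spaces.linear sc sc T" "vector_space.peval sc T p x = 0" "p \<noteq> 0"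
  shows "\<exists>cs. set cs \<subseteq> operator_spectrum sc T \<and> shift_prod sc T cs x = 0"
proof -
  interpret vector_space sc by (rule linearD(1)[OF assms(1)])
  \<comment> \<open>Generalised for induction on the degree: \<open>ds\<close> collects the spectral
    roots already split off, and \<open>p\<close> is the cofactor still to be factored.\<close>
  have "\<exists>cs. set cs \<subseteq> operator_spectrum sc T \<and> shift_prod sc T cs x = 0"
    if "p \<noteq> 0" "shift_prod sc T ds (peval T p x) = 0" "set ds \<subseteq> operator_spectrum sc T" for ds
    using that
  proof (induction "degree p" arbitrary: p ds)
    case 0
    then obtain a where a: "p = [:a:]" "a \<noteq> 0"
      by (metis degree_eq_zeroE pCons_0_0)
    then have "sc a (shift_prod sc T ds x) = 0"
      using 0 by (simp add: peval_def[OF assms(1)] linearD[OF linear_shift_prod[OF assms(1)]])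
    then show ?case using a 0 by auto
  next
    case (Suc n)
    have "\<not> constant (poly p)"
      using Suc.hyps(2) by (simp add: constant_degree)
    then obtain c where "poly p c = 0"
      using fundamental_theorem_of_algebra by blast
    then obtain q where q: "p = [:- c, 1:] * q"
      by (metis dvd_def poly_eq_0_iff_dvd)
    with Suc.prems(1) have "q \<noteq> 0" by auto
    then have n: "n = degree q"
      using Suc.hyps(2) unfolding q by (subst (asm) degree_mult_eq) auto
    let ?y = "shift_prod sc T ds (peval T q x)"
    have y: "T ?y - sc c ?y = 0"
      using Suc.prems(2) unfolding q peval_linear_factor[OF assms(1)]
      by (simp add: linearD[OF linear_shift_prod[OF assms(1)]] shift_prod_commute[OF assms(1)])
    show ?case
    proof (cases "c \<in> operator_spectrum sc T")
      case True
      then show ?thesis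
        using Suc.hyps(1)[OF n \<open>q \<noteq> 0\<close>, of "c # ds"] y Suc.prems(3) by simp
    next
      case False
      then obtain R where R: "Vector_Spaces.linear sc sc R" "\<And>x. R (T x - sc c x) = x"
        unfolding operator_spectrum_def by blast
      \<comment> \<open>Applying \<open>R\<close> to \<open>y\<close> cancels the factor for
        \<open>c\<close>.\<close>
      then have "?y = 0" using y linearD(6)[OF R(1)] by metis
      then show ?thesis using Suc.hyps(1)[OF n \<open>q \<noteq> 0\<close>] Suc.prems(3) by blast
    qed
  qed
  from this[of "[]"] show ?thesis using assms by simp
qed

lemma shift_prod_spectrum_annihilates:
  fixes sc :: "complex \<Rightarrow> 'a::ab_group_add \<Rightarrow> 'a"
  assumes "Vector_Spaces.linear sc sc T" "finite S" "module.span sc S = UNIV"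
  obtains cs where "set cs \<subseteq> operator_spectrum sc T" "\<And>x. shift_prod sc T cs x = 0"
proof -
  interpret vector_space sc by (rule linearD(1)[OF assms(1)])
  have "\<exists>cs. set cs \<subseteq> operator_spectrum sc T \<and> shift_prod sc T cs x = 0" for x
    by (metis annihilating_poly[OF assms] shift_prod_spectrum_annihilates_vector[OF assms(1)])
  then show ?thesis
    using shift_prod_annihilates_span[OF assms(1,2)] assms(3) that by (metis UNIV_I)
qed

section \<open>The Sylvester equation\<close>

lemma sylvester_shift_prod:
  assumes A: "Vector_Spaces.linear t t A" and B: "Vector_Spaces.linear s s B"
    and Y: "Vector_Spaces.linear s t Y"
  shows "\<exists>W. Vector_Spaces.linear s t W \<and>
    (\<forall>x. A (W x) - W (B x) = shift_prod t A cs (Y x) - Y (shift_prod s B cs x))"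
proof (induction cs)
  case Nil
  interpret S: vector_space s by (rule linearD(1)[OF B])
  interpret T: vector_space t by (rule linearD(1)[OF A])
  have "Vector_Spaces.linear s t (\<lambda>x. 0)"
    by (rule linearI) (simp_all add: S.vector_space_axioms T.vector_space_axioms)
  then show ?case
    by (intro exI[of _ "\<lambda>x. 0"]) (simp add: linearD[OF A])
next
  case (Cons c cs)
  interpret S: vector_space s by (rule linearD(1)[OF B])
  interpret T: vector_space t by (rule linearD(1)[OF A])
  from Cons obtain W where W: "Vector_Spaces.linear s t W"
    and eq: "\<And>x. A (W x) - W (B x) = shift_prod t A cs (Y x) - Y (shift_prod s B cs x)"
    by blast
  note lins = linearD[OF A] linearD[OF B] linearD[OF Y] linearD[OF W]
    linearD[OF S.linear_shift_prod[OF B]]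
  \<comment> \<open>With \<open>p\<close> the product over \<open>cs\<close>,
    \<open>(A-c)p(A)Y - Y(B-c)p(B)\<close> equals
    \<open>(A-c)(p(A)Y - Yp(B)) + (AY - YB)p(B)\<close>. As \<open>A\<close> commutes with
    \<open>A-c\<close> and \<open>B\<close> with \<open>p(B)\<close>, the two summands come from
    \<open>(A-c)W\<close> and \<open>Yp(B)\<close>.\<close>
  let ?W = "\<lambda>x. A (W x) - t c (W x) + Y (shift_prod s B cs x)"
  have "Vector_Spaces.linear s t ?W"
    by (rule linearI) (simp_all add: lins algebra_simps)
  moreover have "A (?W x) - ?W (B x) = shift_prod t A (c # cs) (Y x) - Y (shift_prod s B (c # cs) x)"
    for x
  proof -
    let ?p = "shift_prod t A cs (Y x)" and ?q = "shift_prod s B cs x"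
    have "A (?W x) - ?W (B x) = A (A (W x) - W (B x)) - t c (A (W x) - W (B x)) + A (Y ?q) - Y (B ?q)"
      by (simp add: lins S.shift_prod_commute[OF B] algebra_simps)
    also have "\<dots> = A ?p - t c ?p - Y (B ?q - s c ?q)"
      unfolding eq by (simp add: lins algebra_simps)
    finally show ?thesis by simp
  qed
  ultimately show ?case by blast
qed

lemma shift_prod_intertwine:
  assumes "Vector_Spaces.linear s t Z" "\<And>x. A (Z x) = Z (B x)"
  shows "shift_prod t A cs (Z x) = Z (shift_prod s B cs x)"
  using assms(2) by (induction cs) (simp_all add: linearD[OF assms(1)])

theorem theorem1:
  fixes scaleH :: "complex \<Rightarrow> 'h::ab_group_add \<Rightarrow> 'h"
    and ipH :: "'h \<Rightarrow> 'h \<Rightarrow> complex"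
    and scaleK :: "complex \<Rightarrow> 'k::ab_group_add \<Rightarrow> 'k"
    and ipK :: "'k \<Rightarrow> 'k \<Rightarrow> complex"
    and A :: "'k \<Rightarrow> 'k" and B :: "'h \<Rightarrow> 'h"
  assumes "finite_dim_complex_hilbert_space scaleH ipH"
    and "finite_dim_complex_hilbert_space scaleK ipK"
    and "Vector_Spaces.linear scaleK scaleK A"
    and "Vector_Spaces.linear scaleH scaleH B"
    and "operator_spectrum scaleK A \<inter> operator_spectrum scaleH B = {}"
  shows "\<forall>Y. Vector_Spaces.linear scaleH scaleK Y \<longrightarrow>
           (\<exists>!X. Vector_Spaces.linear scaleH scaleK X \<and> (\<forall>x. A (X x) - X (B x) = Y x))"
proof (intro allI impI)
  fix Y assume Y: "Vector_Spaces.linear scaleH scaleK Y"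
  interpret H: finite_dim_complex_hilbert_space scaleH ipH by fact
  interpret K: vector_space scaleK by (rule linearD(1)[OF assms(3)])
  note lins = linearD[OF assms(3)] linearD[OF assms(4)] linearD[OF Y]
  obtain S where "finite S" "H.span S = UNIV"
    using H.finite_dim by blast
  then obtain cs where cs: "set cs \<subseteq> operator_spectrum scaleH B"
    "\<And>x. shift_prod scaleH B cs x = 0"
    using shift_prod_spectrum_annihilates[OF assms(4)] by blast
  \<comment> \<open>Every \<open>c\<close> in \<open>cs\<close> lies in the spectrum of
    \<open>B\<close>, hence outside that of \<open>A\<close>.\<close>
  have "\<exists>R. Vector_Spaces.linear scaleK scaleK R \<and>
      (\<forall>x. R (A x - scaleK c x) = x) \<and> (\<forall>x. A (R x) - scaleK c (R x) = x)" if "c \<in> set cs" for c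
    using that cs(1) assms(5) unfolding operator_spectrum_def by blast
  then obtain Q where Q: "Vector_Spaces.linear scaleK scaleK Q"
    "\<And>x. Q (shift_prod scaleK A cs x) = x" "\<And>x. Q (A x) = A (Q x)"
    using K.shift_prod_inverse[OF assms(3)] by metis
  obtain W where W: "Vector_Spaces.linear scaleH scaleK W"
    "\<And>x. A (W x) - W (B x) = shift_prod scaleK A cs (Y x)"
    using sylvester_shift_prod[OF assms(3,4) Y, of cs] by (auto simp: cs(2) lins)
  show "\<exists>!X. Vector_Spaces.linear scaleH scaleK X \<and> (\<forall>x. A (X x) - X (B x) = Y x)"
  proof (rule ex1I[of _ "\<lambda>x. Q (W x)"], intro conjI allI)
    show "Vector_Spaces.linear scaleH scaleK (\<lambda>x. Q (W x))"
      by (rule linearI) (simp_all add: lins linearD[OF Q(1)] linearD[OF W(1)])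
    \<comment> \<open>\<open>Q\<close> commutes with \<open>A\<close>, so the left side is
      \<open>Q\<close> applied to \<open>A (W x) - W (B x)\<close>, and \<open>Q\<close> undoes the
      product in \<open>A\<close>.\<close>
    show sol: "A (Q (W x)) - Q (W (B x)) = Y x" for x
      by (metis Q linearD(5)[OF Q(1)] W(2))
    fix X assume X: "Vector_Spaces.linear scaleH scaleK X \<and> (\<forall>x. A (X x) - X (B x) = Y x)"
    let ?Z = "\<lambda>x. X x - Q (W x)"
    have Z: "Vector_Spaces.linear scaleH scaleK ?Z"
      by (rule linearI)
        (simp_all add: lins linearD[OF Q(1)] linearD[OF W(1)] linearD[OF conjunct1[OF X]]
          K.scale_right_diff_distrib)
    \<comment> \<open>The difference of two solutions solves the homogeneous equation, so it
      intertwines the two products; the one in \<open>B\<close> is zero and the one in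
      \<open>A\<close> is injective.\<close>
    have "A (?Z x) = ?Z (B x)" for x
    proof -
      have "A (X x) - X (B x) = A (Q (W x)) - Q (W (B x))"
        using X sol by simp
      then show ?thesis by (simp add: lins algebra_simps)
    qed
    then have "shift_prod scaleK A cs (?Z x) = 0" for x
      using shift_prod_intertwine[OF Z, of A B] by (simp add: cs(2) linearD(6)[OF Z])
    then have "?Z x = 0" for x
      using Q(2)[of "?Z x"] linearD(6)[OF Q(1)] by simp
    then show "X = (\<lambda>x. Q (W x))" by auto
  qed
qed

end
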